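(* Let $H$ be a fixed non-matching graph with $e(H)\ge 3$ and let $\ell$ be an integer. If $e(H)\le\ell\le (e(H)-1)^{e(H)/(e(H)-2)}$, then $\lambda(H,\ell)=\log(e(H)-1)$.
   Context: All graphs are finite and simple; $v(G)$, $e(G)$ denote numbers of vertices and edges. $H$ has no isolated vertices (isolated vertices play no role and are deleted). $H$ is non-matching if it contains two adjacent edges. Logarithms are natural. $[s]=\{1,\dots,s\}$. Copies of graphs are not required to be induced. An $\ell$-palette template on $K_n$ is a map $\mathcal P:E(K_n)\to 2^{[\ell]}\setminus\{\emptyset\}$. A finite family of sets $A_1,\dots,A_q$ has a system of distinct representatives (SDR) if there are pairwise distinct $a_i\in A_i$. The template $\mathcal P$ is $H$-SDR-free if on every copy of $H$ in $K_n$ the palettes assigned to its edges have no SDR. Let $\operatorname{ex}_{\log}(n;H,\ell)$ be the maximum of $\sum_{e\in E(K_n)}\log|\mathcal P(e)|$ over all $H$-SDR-free $\ell$-palette templates $\mathcal P$ on $K_n$, and define $$\lambda(H,\ell)=\inf_{n\ge v(H)}\frac{\operatorname{ex}_{\log}(n;H,\ell)}{\binom n2}.$$ *)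

theory Defs
  imports Complex_Main "HOL-Library.FuncSet"
begin

text \<open>A graph is a pair of a vertex set and a set of edges, each edge being a two-element
  set of vertices.\<close>

type_synonym 'a ugraph = "'a set \<times> 'a set set"

abbreviation verts :: "'a ugraph \<Rightarrow> 'a set" where
  "verts \<equiv> fst"

abbreviation edges :: "'a ugraph \<Rightarrow> 'a set set" where
  "edges \<equiv> snd"

definition pairs_of :: "'a set \<Rightarrow> 'a set set" where
  "pairs_of V = {e. e \<subseteq> V \<and> card e = 2}"

definition finite_simple_graph :: "'a ugraph \<Rightarrow> bool" where
  "finite_simple_graph G \<longleftrightarrow> finite (verts G) \<and> edges G \<subseteq> pairs_of (verts G)"

definition no_isolated_vertices :: "'a ugraph \<Rightarrow> bool" where
  "no_isolated_vertices G \<longleftrightarrow> (\<forall>v\<in>verts G. \<exists>e\<in>edges G. v \<in> e)"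

definition non_matching :: "'a ugraph \<Rightarrow> bool" where
  "non_matching G \<longleftrightarrow> (\<exists>e\<in>edges G. \<exists>e'\<in>edges G. e \<noteq> e' \<and> e \<inter> e' \<noteq> {})"

definition complete_graph :: "nat \<Rightarrow> nat ugraph" where
  "complete_graph n = ({1..n}, pairs_of {1..n})"

definition subgraph_of :: "'a ugraph \<Rightarrow> 'a ugraph \<Rightarrow> bool" where
  "subgraph_of C G \<longleftrightarrow> verts C \<subseteq> verts G \<and> edges C \<subseteq> edges G"

definition isomorphic_graphs :: "'a ugraph \<Rightarrow> 'b ugraph \<Rightarrow> bool" where
  "isomorphic_graphs H C \<longleftrightarrow>
     (\<exists>f. bij_betw f (verts H) (verts C) \<and> edges C = (\<lambda>e. f ` e) ` edges H)"

definition copies_of :: "'a ugraph \<Rightarrow> 'b ugraph \<Rightarrow> 'b ugraph set" where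
  "copies_of H G = {C. subgraph_of C G \<and> isomorphic_graphs H C}"

definition has_SDR :: "'i set \<Rightarrow> ('i \<Rightarrow> 'c set) \<Rightarrow> bool" where
  "has_SDR I A \<longleftrightarrow> (\<exists>a. inj_on a I \<and> (\<forall>i\<in>I. a i \<in> A i))"

definition palette_templates :: "nat \<Rightarrow> nat \<Rightarrow> (nat set \<Rightarrow> nat set) set" where
  "palette_templates l n = edges (complete_graph n) \<rightarrow>\<^sub>E (Pow {1..l} - {{}})"

definition SDR_free :: "'a ugraph \<Rightarrow> nat \<Rightarrow> (nat set \<Rightarrow> nat set) \<Rightarrow> bool" where
  "SDR_free H n P \<longleftrightarrow> (\<forall>C\<in>copies_of H (complete_graph n). \<not> has_SDR (edges C) P)"

definition ex_log :: "nat \<Rightarrow> 'a ugraph \<Rightarrow> nat \<Rightarrow> real" where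
  "ex_log n H l =
     Max ((\<lambda>P. \<Sum>e\<in>edges (complete_graph n). ln (real (card (P e)))) `
       {P \<in> palette_templates l n. SDR_free H n P})"

definition lambda_density :: "'a ugraph \<Rightarrow> nat \<Rightarrow> real" where
  "lambda_density H l = (INF n\<in>{card (verts H)..}. ex_log n H l / real (n choose 2))"

text \<open>The maximum and the infimum above are over sets on which they are meaningful.\<close>

lemma finite_palette_templates: "finite (palette_templates l n)"
  unfolding palette_templates_def complete_graph_def pairs_of_def
  by (intro finite_PiE) (auto intro: finite_subset[of _ "Pow {1..n}"])

lemma SDR_free_template_exists:
  assumes "finite_simple_graph H" "card (edges H) \<ge> 2" "l \<ge> 1"
  shows "{P \<in> palette_templates l n. SDR_free H n P} \<noteq> {}"
proof -
  let ?P = "\<lambda>e\<in>edges (complete_graph n). {1::nat}"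
  have "\<not> has_SDR (edges C) ?P" if C: "C \<in> copies_of H (complete_graph n)" for C
  proof
    assume "has_SDR (edges C) ?P"
    then obtain a where inj: "inj_on a (edges C)" and a: "\<forall>e\<in>edges C. a e \<in> ?P e"
      by (auto simp: has_SDR_def)
    have sub: "edges C \<subseteq> edges (complete_graph n)"
      using C by (auto simp: copies_of_def subgraph_of_def)
    have one: "a e = 1" if "e \<in> edges C" for e
      using a sub that by (metis restrict_apply' singletonD subsetD)
    obtain f where f: "bij_betw f (verts H) (verts C)"
      and E: "edges C = (\<lambda>e. f ` e) ` edges H"
      using C by (auto simp: copies_of_def isomorphic_graphs_def)
    have "edges H \<subseteq> Pow (verts H)"
      using assms(1) by (auto simp: finite_simple_graph_def pairs_of_def)
    then have "inj_on (\<lambda>e. f ` e) (edges H)"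
      using f by (meson bij_betw_imp_inj_on inj_on_image_Pow inj_on_subset)
    then have "card (edges C) \<ge> 2"
      using E assms(2) by (simp add: card_image)
    moreover have "card (edges C) = card (a ` edges C)"
      using inj by (simp add: card_image)
    moreover have "card (a ` edges C) \<le> card {1::nat}"
      using one by (intro card_mono) auto
    ultimately show False by simp
  qed
  moreover have "?P \<in> palette_templates l n"
    using assms(3) by (auto simp: palette_templates_def)
  ultimately show ?thesis by (auto simp: SDR_free_def)
qed

lemma ex_log_nonneg:
  assumes "finite_simple_graph H" "card (edges H) \<ge> 2" "l \<ge> 1"
  shows "0 \<le> ex_log n H l"
proof -
  let ?T = "{P \<in> palette_templates l n. SDR_free H n P}"
  let ?w = "\<lambda>P. \<Sum>e\<in>edges (complete_graph n). ln (real (card (P e)))"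
  obtain P where P: "P \<in> ?T" using SDR_free_template_exists[OF assms] by blast
  have "0 \<le> ?w P"
  proof (rule sum_nonneg)
    fix e assume "e \<in> edges (complete_graph n)"
    then have "P e \<subseteq> {1..l}" "P e \<noteq> {}"
      using P by (auto simp: palette_templates_def PiE_iff)
    then have "card (P e) \<ge> 1"
      by (metis card_gt_0_iff finite_atLeastAtMost finite_subset One_nat_def Suc_leI)
    then show "0 \<le> ln (real (card (P e)))" by simp
  qed
  also have "?w P \<le> ex_log n H l"
    unfolding ex_log_def using P by (intro Max_ge) (auto simp: finite_palette_templates)
  finally show ?thesis .
qed

end

theory Submission
  imports Defs "HOL-Analysis.Convex" "HOL-Combinatorics.Permutations"
begin

text \<open>If a copy of \<open>H\<close> with \<open>m\<close> edges has no SDR, Hall's theorem gives \<open>s \<ge> 2\<close> of its edges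
  whose palettes have a union of size at most \<open>s - 1\<close>, so the product of the palette sizes is at
  most \<open>(s - 1)\<^sup>s l\<^sup>m\<^sup>-\<^sup>s\<close>. The logarithm of this bound is convex in \<open>s\<close>, hence maximal at \<open>s = m\<close>
  or \<open>s = 2\<close>, and the hypothesis on \<open>l\<close> says precisely that the value at \<open>s = 2\<close> does not exceed
  the value \<open>(m - 1)\<^sup>m\<close> at \<open>s = m\<close>. Averaging over all copies bounds the average of
  \<open>ln |P e|\<close> over the edges of \<open>K\<^sub>n\<close> by \<open>ln (m - 1)\<close>, and the template with all palettes equal to
  \<open>{1..m-1}\<close> attains this value.\<close>

section \<open>Hall's marriage theorem\<close>

theorem Hall_SDR:
  assumes "finite I" and "\<And>i. i \<in> I \<Longrightarrow> finite (A i)"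
    and "\<And>J. J \<subseteq> I \<Longrightarrow> card J \<le> card (\<Union>(A ` J))"
  shows "has_SDR I A"
  using assms
proof (induction "card I" arbitrary: I A rule: less_induct)
  case less
  note fin = less.prems(1) and finA = less.prems(2) and hall = less.prems(3)
  show ?case
  \<comment> \<open>Halmos-Vaughan induction: either some nonempty proper subfamily is tight and the
    family splits there, or every such subfamily has a spare element.\<close>
  proof (cases "\<exists>J. J \<subset> I \<and> J \<noteq> {} \<and> card (\<Union>(A ` J)) = card J")
    case True
    then obtain J where J: "J \<subset> I" "J \<noteq> {}" and tight: "card (\<Union>(A ` J)) = card J"
      by blast
    let ?B = "\<lambda>i. A i - \<Union>(A ` J)"
    have finJ: "finite J" using J fin finite_subset by blast
    have "has_SDR J A"
      using J fin finA hall finJ by (intro less.hyps) (auto intro: psubset_card_mono)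
    then obtain a where a: "inj_on a J" "\<forall>i\<in>J. a i \<in> A i" by (auto simp: has_SDR_def)
    have "has_SDR (I - J) ?B"
    proof (rule less.hyps)
      show "card (I - J) < card I" using J fin by (intro psubset_card_mono) auto
      fix K assume K: "K \<subseteq> I - J"
      have finK: "finite K" using K fin finite_subset by blast
      have "card K + card J = card (K \<union> J)"
        using K finK finJ by (subst card_Un_disjoint) auto
      also have "\<dots> \<le> card (\<Union>(A ` (K \<union> J)))" using K J by (intro hall) auto
      also have "\<Union>(A ` (K \<union> J)) = \<Union>(?B ` K) \<union> \<Union>(A ` J)" by auto
      also have "card \<dots> \<le> card (\<Union>(?B ` K)) + card (\<Union>(A ` J))" by (rule card_Un_le)
      finally show "card K \<le> card (\<Union>(?B ` K))" using tight by simp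
    qed (use fin finA in auto)
    then obtain b where b: "inj_on b (I - J)" "\<forall>i\<in>I - J. b i \<in> ?B i"
      by (auto simp: has_SDR_def)
    let ?c = "\<lambda>i. if i \<in> J then a i else b i"
    have "a ` J \<inter> b ` (I - J) = {}" using a b by fastforce
    from inj_on_disjoint_Un[OF a(1) b(1) this] have "inj_on ?c I"
      using J by (simp add: Un_absorb1 psubset_imp_subset)
    moreover have "\<forall>i\<in>I. ?c i \<in> A i" using a b by auto
    ultimately show ?thesis unfolding has_SDR_def by blast
  next
    case False
    show ?thesis
    proof (cases "I = {}")
      case True
      then show ?thesis by (simp add: has_SDR_def)
    next
      case nonempty: False
      then obtain i where i: "i \<in> I" by blast
      have "A i \<noteq> {}" using hall[of "{i}"] i by auto
      then obtain x where x: "x \<in> A i" by blast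
      \<comment> \<open>Represent \<open>i\<close> by an arbitrary \<open>x\<close> and delete
        \<open>x\<close> elsewhere. No nonempty proper subfamily is tight, so each has a surplus of
        at least one, which pays for the deletion.\<close>
      let ?B = "\<lambda>j. A j - {x}"
      have "has_SDR (I - {i}) ?B"
      proof (rule less.hyps)
        show "card (I - {i}) < card I" using i fin by (intro psubset_card_mono) auto
        fix K assume K: "K \<subseteq> I - {i}"
        show "card K \<le> card (\<Union>(?B ` K))"
        proof (cases "K = {}")
          case nonemptyK: False
          have "K \<subset> I" using K i by blast
          then have "card (\<Union>(A ` K)) \<noteq> card K" using False nonemptyK by blast
          moreover have "card K \<le> card (\<Union>(A ` K))" using K by (intro hall) auto
          moreover have "card (\<Union>(A ` K)) - card {x} \<le> card (\<Union>(A ` K) - {x})"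
            by (intro diff_card_le_card_Diff) auto
          moreover have "\<Union>(?B ` K) = \<Union>(A ` K) - {x}" by auto
          ultimately show ?thesis by simp
        qed simp
      qed (use fin finA in auto)
      then obtain b where b: "inj_on b (I - {i})" "\<forall>j\<in>I - {i}. b j \<in> ?B j"
        by (auto simp: has_SDR_def)
      have "inj_on (b(i := x)) I" "\<forall>j\<in>I. (b(i := x)) j \<in> A j"
        using b x by (auto simp: inj_on_def)
      then show ?thesis unfolding has_SDR_def by blast
    qed
  qed
qed

section \<open>Convexity and the bound on a single copy\<close>

lemma convex_on_mult_ln_pred: "convex_on {2..} (\<lambda>x::real. x * ln (x - 1))"
proof (rule f''_ge0_imp_convex)
  fix x :: real assume "x \<in> {2..}"
  then have x: "x \<ge> 2" by simp
  show "((\<lambda>x. x * ln (x - 1)) has_real_derivative ln (x - 1) + x / (x - 1)) (at x)"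
    using x by (auto intro!: derivative_eq_intros)
  \<comment> \<open>The second derivative changes sign at 2, which is why the interval starts there.
    Partial fractions give it the shape that the differentiation rules produce.\<close>
  have "(x - 2) / (x - 1)\<^sup>2 = ((x - 1) - 1) / (x - 1)\<^sup>2" by simp
  also have "\<dots> = 1 / (x - 1) - 1 / (x - 1)\<^sup>2"
    using x by (subst diff_divide_distrib) (simp add: power2_eq_square)
  finally have eq: "(x - 2) / (x - 1)\<^sup>2 = 1 / (x - 1) - 1 / (x - 1)\<^sup>2" .
  show "((\<lambda>x. ln (x - 1) + x / (x - 1)) has_real_derivative (x - 2) / (x - 1)\<^sup>2) (at x)"
    unfolding eq using x by (auto intro!: derivative_eq_intros simp: power2_eq_square)
  show "0 \<le> (x - 2) / (x - 1)\<^sup>2" using x by simp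
qed simp

text \<open>The convex function \<open>x * ln (x - 1)\<close> vanishes at 2, so its chord over
  \<open>[2, m]\<close> consists of the endpoint term at \<open>m\<close> alone, weighted by the
  relative position \<open>t\<close> of \<open>s\<close>.\<close>

lemma mult_ln_pred_le_chord:
  fixes s m :: real
  assumes "2 \<le> s" "s \<le> m" "2 < m"
  shows "s * ln (s - 1) \<le> (s - 2) / (m - 2) * (m * ln (m - 1))"
proof -
  define t where "t = (s - 2) / (m - 2)"
  have t: "0 \<le> t" "t \<le> 1" and "t * (m - 2) = s - 2"
    using assms by (auto simp: t_def)
  then have s: "(1 - t) * 2 + t * m = s" by (simp add: algebra_simps)
  have "((1 - t) *\<^sub>R 2 + t *\<^sub>R m) * ln (((1 - t) *\<^sub>R 2 + t *\<^sub>R m) - 1)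
      \<le> (1 - t) * (2 * ln (2 - 1)) + t * (m * ln (m - 1))"
    using t assms by (intro convex_onD[OF convex_on_mult_ln_pred]) auto
  then have "s * ln (s - 1) \<le> t * (m * ln (m - 1))"
    unfolding real_scaleR_def s by simp
  then show ?thesis by (simp only: t_def)
qed

text \<open>In logarithms the hypothesis on \<open>l\<close> charges at most
  \<open>m / (m - 2) * ln (m - 1)\<close> to each edge outside the Hall violator \<open>J\<close>;
  the chord bound charges \<open>s - 2\<close> times this amount to \<open>J\<close>. With the
  \<open>m - s\<close> remaining edges the total is \<open>m - 2\<close> such charges.\<close>

lemma sum_ln_card_le_if_no_SDR:
  fixes I :: "'i set" and A :: "'i \<Rightarrow> 'c set" and l :: nat
  defines "m \<equiv> real (card I)"
  assumes "finite I" "card I \<ge> 3"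
    and A: "\<And>i. i \<in> I \<Longrightarrow> finite (A i) \<and> A i \<noteq> {} \<and> card (A i) \<le> l"
    and l: "real l \<le> (m - 1) powr (m / (m - 2))"
    and no_SDR: "\<not> has_SDR I A"
  shows "(\<Sum>i\<in>I. ln (real (card (A i)))) \<le> m * ln (m - 1)"
proof -
  have m: "m \<ge> 3" using assms by simp
  have pos: "card (A i) \<ge> 1" if "i \<in> I" for i
    using A[OF that] by (simp add: Suc_le_eq card_gt_0_iff)
  obtain J where J: "J \<subseteq> I" and small: "card (\<Union>(A ` J)) < card J"
    using Hall_SDR[of I A] no_SDR A \<open>finite I\<close> by (meson not_le)
  have finJ: "finite J" using J \<open>finite I\<close> finite_subset by blast
  have card_J: "card (A i) \<le> card J - 1" if "i \<in> J" for i
  proof -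
    have "card (A i) \<le> card (\<Union>(A ` J))"
      using J A finJ that by (intro card_mono) auto
    then show ?thesis using small by simp
  qed
  define s where "s = real (card J)"
  obtain j where j: "j \<in> J" using small by fastforce
  \<comment> \<open>A violator with one member would have an empty palette, and palettes are
    nonempty.\<close>
  have "card J \<ge> 2" using card_J[OF j] pos[of j] j J by auto
  then have s2: "2 \<le> s" by (simp add: s_def)
  have sm: "s \<le> m" using J \<open>finite I\<close> by (simp add: s_def m_def card_mono)
  have l1: "l \<ge> 1" using pos[of j] A[of j] j J by force
  have "ln (real l) \<le> ln ((m - 1) powr (m / (m - 2)))"
    using l l1 m by (subst ln_le_cancel_iff) auto
  also have "\<dots> = m / (m - 2) * ln (m - 1)" using m by (simp add: ln_powr)
  finally have ln_l: "ln (real l) \<le> m / (m - 2) * ln (m - 1)" .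
  have "(\<Sum>i\<in>I. ln (real (card (A i))))
      = (\<Sum>i\<in>J. ln (real (card (A i)))) + (\<Sum>i\<in>I - J. ln (real (card (A i))))"
    using J \<open>finite I\<close> by (metis add.commute sum.subset_diff)
  \<comment> \<open>Inside \<open>J\<close> each palette lies in a union of fewer than
    \<open>s\<close> colours; outside, only the bound \<open>l\<close> is available.\<close>
  also have "\<dots> \<le> (\<Sum>i\<in>J. ln (s - 1)) + (\<Sum>i\<in>I - J. m / (m - 2) * ln (m - 1))"
  proof (intro add_mono sum_mono)
    fix i assume i: "i \<in> J"
    then have "real (card (A i)) \<le> s - 1"
      using card_J[OF i] \<open>card J \<ge> 2\<close> by (simp add: s_def)
    moreover have "real (card (A i)) > 0" using pos[of i] i J by auto
    ultimately show "ln (real (card (A i))) \<le> ln (s - 1)" by simp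
  next
    fix i assume i: "i \<in> I - J"
    then have "ln (real (card (A i))) \<le> ln (real l)" using pos[of i] A[of i] by auto
    then show "ln (real (card (A i))) \<le> m / (m - 2) * ln (m - 1)" using ln_l by simp
  qed
  also have "\<dots> = s * ln (s - 1) + (m - s) * (m / (m - 2) * ln (m - 1))"
    using J finJ \<open>finite I\<close> by (simp add: card_Diff_subset s_def m_def of_nat_diff card_mono)
  also have "\<dots> \<le> (s - 2) / (m - 2) * (m * ln (m - 1)) + (m - s) * (m / (m - 2) * ln (m - 1))"
    using mult_ln_pred_le_chord[of s m] s2 sm m by simp
  also have "\<dots> = ((s - 2) + (m - s)) / (m - 2) * (m * ln (m - 1))"
    by (simp only: add_divide_distrib distrib_right times_divide_eq_left times_divide_eq_right)
  also have "\<dots> = m * ln (m - 1)" using m by simp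
  finally show ?thesis .
qed

section \<open>Averaging over the copies of \<open>H\<close> in the complete graph\<close>

lemma exists_permutes_image:
  assumes "finite V" "e \<subseteq> V" "e' \<subseteq> V" "card e = card e'"
  shows "\<exists>q. q permutes V \<and> q ` e = e'"
proof -
  have fin: "finite e" "finite e'" using assms finite_subset by auto
  obtain f where f: "bij_betw f e e'" using finite_same_card_bij assms(4) fin by blast
  have "card (V - e) = card (V - e')" using assms fin by (simp add: card_Diff_subset)
  then obtain g where g: "bij_betw g (V - e) (V - e')"
    using finite_same_card_bij[of "V - e" "V - e'"] assms(1) by auto
  let ?h = "\<lambda>x. if x \<in> e then f x else g x"
  let ?q = "\<lambda>x. if x \<in> V then ?h x else x"
  have "bij_betw ?h (e \<union> (V - e)) (e' \<union> (V - e'))"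
    by (rule bij_betw_disjoint_Un[OF f g]) auto
  then have "bij_betw ?h V V" using assms by (simp add: Un_absorb1)
  then have "bij_betw ?q V V" by (rule bij_betw_cong[THEN iffD1, rotated]) simp
  then have "?q permutes V" by (rule bij_imp_permutes) simp
  moreover have "?q ` e = f ` e" using assms by (intro image_cong) auto
  then have "?q ` e = e'" using f by (simp add: bij_betw_def)
  ultimately show ?thesis by blast
qed

text \<open>The symmetric group acts transitively on pairs, so the sum over permutations is the same
  for every pair. Summing it over all pairs and swapping the sums gives the total weight once for
  each permutation.\<close>

lemma sum_permutes_pairs_of:
  fixes w :: "'b set \<Rightarrow> real"
  assumes "finite V" "e \<in> pairs_of V"
  shows "real (card V choose 2) * (\<Sum>p | p permutes V. w (p ` e))
      = fact (card V) * (\<Sum>e\<in>pairs_of V. w e)"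
proof -
  have "real (card V choose 2) * (\<Sum>p | p permutes V. w (p ` e))
      = (\<Sum>e'\<in>pairs_of V. \<Sum>p | p permutes V. w (p ` e))"
    using n_subsets[OF assms(1), of 2] by (simp add: pairs_of_def)
  also have "\<dots> = (\<Sum>e'\<in>pairs_of V. \<Sum>p | p permutes V. w (p ` e'))"
  proof (rule sum.cong[OF refl])
    fix e' assume "e' \<in> pairs_of V"
    then obtain q where q: "q permutes V" "q ` e = e'"
      using exists_permutes_image[of V e e'] assms by (auto simp: pairs_of_def)
    show "(\<Sum>p | p permutes V. w (p ` e)) = (\<Sum>p | p permutes V. w (p ` e'))"
      by (subst sum_permutations_compose_right[OF q(1)]) (simp add: image_comp flip: q(2))
  qed
  also have "\<dots> = (\<Sum>p | p permutes V. \<Sum>e'\<in>pairs_of V. w (p ` e'))" by (rule sum.swap)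
  also have "\<dots> = (\<Sum>p | p permutes V. \<Sum>e\<in>pairs_of V. w e)"
  proof (rule sum.cong[OF refl])
    have maps: "p ` e' \<in> pairs_of V" if "p permutes V" "e' \<in> pairs_of V" for p e'
      using that permutes_image[OF that(1)] permutes_inj[OF that(1)]
      by (auto simp: pairs_of_def card_image inj_on_subset)
    fix p assume "p \<in> {p. p permutes V}"
    then have p: "p permutes V" by simp
    show "(\<Sum>e'\<in>pairs_of V. w (p ` e')) = (\<Sum>e\<in>pairs_of V. w e)"
      by (rule sum.reindex_bij_witness[of _ "image (inv p)" "image p"])
        (use p maps permutes_inv[OF p] in
          \<open>auto simp: image_comp permutes_inv_o[OF p]\<close>)
  qed
  also have "\<dots> = fact (card V) * (\<Sum>e\<in>pairs_of V. w e)"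
    using card_permutations[OF refl assms(1)] by simp
  finally show ?thesis .
qed

text \<open>Fix one embedding \<open>\<phi>\<close> of \<open>H\<close> and move it by all
  permutations of the vertices. Each edge of \<open>H\<close> then visits all pairs equally often,
  so a bound \<open>c\<close> on the average weight in every copy bounds the average over all
  pairs.\<close>

lemma sum_pairs_of_le_if_copies_le:
  fixes w :: "nat set \<Rightarrow> real"
  assumes H: "finite_simple_graph H" and "edges H \<noteq> {}" and n: "card (verts H) \<le> n"
    and copies: "\<And>C. C \<in> copies_of H (complete_graph n) \<Longrightarrow>
      (\<Sum>e\<in>edges C. w e) \<le> real (card (edges H)) * c"
  shows "(\<Sum>e\<in>pairs_of {1..n}. w e) \<le> real (n choose 2) * c"
proof -
  let ?V = "{1..n}" and ?S = "{p. p permutes {1..n}}"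
  have finV: "finite (verts H)" and EH: "edges H \<subseteq> pairs_of (verts H)"
    using H by (auto simp: finite_simple_graph_def)
  then have "finite (edges H)" by (auto simp: pairs_of_def intro: finite_subset[of _ "Pow (verts H)"])
  then have m: "card (edges H) > 0" using \<open>edges H \<noteq> {}\<close> by (simp add: card_gt_0_iff)
  obtain \<phi> where \<phi>: "\<phi> ` verts H \<subseteq> ?V" "inj_on \<phi> (verts H)"
    using card_le_inj[of "verts H" ?V] finV n by auto
  have image: "g ` e \<in> pairs_of ?V"
    if "inj_on g (verts H)" "g ` verts H \<subseteq> ?V" "e \<in> edges H" for g e
    using that EH by (fastforce simp: pairs_of_def card_image inj_on_subset)
  have "(\<Sum>e\<in>edges H. w (p ` \<phi> ` e)) \<le> real (card (edges H)) * c" if "p permutes ?V" for p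
  proof -
    let ?g = "p \<circ> \<phi>"
    have g: "inj_on ?g (verts H)" "?g ` verts H \<subseteq> ?V"
      using \<phi> permutes_inj[OF that] permutes_image[OF that]
      by (auto intro: comp_inj_on inj_on_subset)
    have inj: "inj_on (image ?g) (edges H)"
      using g(1) EH by (intro inj_on_subset[OF inj_on_image_Pow[OF g(1)]]) (auto simp: pairs_of_def)
    let ?C = "(?g ` verts H, image ?g ` edges H)"
    have "?C \<in> copies_of H (complete_graph n)"
      using g image[OF g]
      by (auto simp: copies_of_def subgraph_of_def complete_graph_def isomorphic_graphs_def
          bij_betw_def)
    then have "(\<Sum>e\<in>image ?g ` edges H. w e) \<le> real (card (edges H)) * c"
      using copies by fastforce
    then show ?thesis by (subst (asm) sum.reindex[OF inj]) (simp add: image_comp)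
  qed
  \<comment> \<open>Different \<open>p\<close> may give the same copy; this is harmless, because the
    bound holds for each \<open>p\<close> separately.\<close>
  then have "(\<Sum>p\<in>?S. \<Sum>e\<in>edges H. w (p ` \<phi> ` e)) \<le> (\<Sum>p\<in>?S. real (card (edges H)) * c)"
    by (intro sum_mono) simp
  also have "\<dots> = fact n * (real (card (edges H)) * c)"
    using card_permutations[of ?V n] by simp
  finally have le: "(\<Sum>e\<in>edges H. \<Sum>p\<in>?S. w (p ` \<phi> ` e)) \<le> fact n * (real (card (edges H)) * c)"
    by (subst sum.swap)
  \<comment> \<open>To avoid division, the factors \<open>card (edges H)\<close> and
    \<open>fact n\<close> are carried along and cancelled at the end.\<close>
  have "real (card (edges H)) * (fact n * (\<Sum>e\<in>pairs_of ?V. w e))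
      = (\<Sum>e\<in>edges H. real (n choose 2) * (\<Sum>p\<in>?S. w (p ` \<phi> ` e)))"
    using sum_permutes_pairs_of[of ?V _ w] image[OF \<phi>(2,1)] by simp
  also have "\<dots> = real (n choose 2) * (\<Sum>e\<in>edges H. \<Sum>p\<in>?S. w (p ` \<phi> ` e))"
    by (rule sum_distrib_left[symmetric])
  also have "\<dots> \<le> real (n choose 2) * (fact n * (real (card (edges H)) * c))"
    using le by (rule mult_left_mono) simp
  also have "\<dots> = real (card (edges H)) * (fact n * (real (n choose 2) * c))" by simp
  finally show ?thesis using m by (simp add: mult_le_cancel_left_pos)
qed

section \<open>Matching bounds for \<open>ex_log\<close> and the density\<close>

lemma card_edges_copy:
  assumes "finite_simple_graph H" "C \<in> copies_of H G"
  shows "card (edges C) = card (edges H)"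
proof -
  obtain f where f: "bij_betw f (verts H) (verts C)" "edges C = image f ` edges H"
    using assms(2) by (auto simp: copies_of_def isomorphic_graphs_def)
  have "edges H \<subseteq> Pow (verts H)"
    using assms(1) by (auto simp: finite_simple_graph_def pairs_of_def)
  then have "inj_on (image f) (edges H)"
    using f(1) by (meson bij_betw_imp_inj_on inj_on_image_Pow inj_on_subset)
  then show ?thesis using f(2) by (simp add: card_image)
qed

text \<open>The averaging lemma applies to the weights \<open>ln (card (P e))\<close> with
  \<open>c = ln (m - 1)\<close>, where \<open>m = card (edges H)\<close>; the bound on each copy
  comes from the absence of an SDR there.\<close>

lemma ex_log_le:
  assumes H: "finite_simple_graph H" and "card (edges H) \<ge> 3" "l \<ge> 1"
    and l: "real l \<le> (real (card (edges H)) - 1) powr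
                  (real (card (edges H)) / (real (card (edges H)) - 2))"
    and n: "card (verts H) \<le> n"
  shows "ex_log n H l \<le> real (n choose 2) * ln (real (card (edges H)) - 1)"
proof -
  let ?T = "{P \<in> palette_templates l n. SDR_free H n P}"
  have "(\<Sum>e\<in>edges (complete_graph n). ln (real (card (P e))))
      \<le> real (n choose 2) * ln (real (card (edges H)) - 1)" if P: "P \<in> ?T" for P
  proof -
    have "(\<Sum>e\<in>pairs_of {1..n}. ln (real (card (P e))))
      \<le> real (n choose 2) * ln (real (card (edges H)) - 1)"
    proof (rule sum_pairs_of_le_if_copies_le[OF H _ n])
      show "edges H \<noteq> {}" using assms(2) by auto
      fix C assume C: "C \<in> copies_of H (complete_graph n)"
      have m: "card (edges C) = card (edges H)" by (rule card_edges_copy[OF H C])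
      have palette: "P e \<in> Pow {1..l} - {{}}" if "e \<in> edges C" for e
        using P C that by (auto simp: palette_templates_def copies_of_def subgraph_of_def)
      have "finite (P e) \<and> P e \<noteq> {} \<and> card (P e) \<le> l" if "e \<in> edges C" for e
        using palette[OF that] card_mono[of "{1..l}" "P e"] by (auto intro: finite_subset)
      moreover have "finite (edges C)" using m assms(2) by (auto intro: card_ge_0_finite)
      moreover have "\<not> has_SDR (edges C) P" using P C by (auto simp: SDR_free_def)
      ultimately show "(\<Sum>e\<in>edges C. ln (real (card (P e))))
          \<le> real (card (edges H)) * ln (real (card (edges H)) - 1)"
        using sum_ln_card_le_if_no_SDR[of "edges C" P l] m assms(2) l by simp
    qed
    then show ?thesis by (simp add: complete_graph_def)
  qed
  moreover have "?T \<noteq> {}" using assms by (intro SDR_free_template_exists) auto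
  ultimately show ?thesis
    unfolding ex_log_def by (subst Max_le_iff) (auto simp: finite_palette_templates)
qed

text \<open>The constant template offers \<open>m - 1\<close> colours in all, too few for the
  \<open>m\<close> edges of a copy. From \<open>2 \<le> m \<le> l\<close> its palette is nonempty
  and lies in \<open>{1..l}\<close>.\<close>

lemma ex_log_ge:
  assumes H: "finite_simple_graph H" and "card (edges H) \<ge> 2" "card (edges H) \<le> l"
  shows "real (n choose 2) * ln (real (card (edges H)) - 1) \<le> ex_log n H l"
proof -
  let ?m = "card (edges H)"
  let ?P = "\<lambda>e\<in>edges (complete_graph n). {1..?m - 1}"
  have "\<not> has_SDR (edges C) ?P" if C: "C \<in> copies_of H (complete_graph n)" for C
  proof
    assume "has_SDR (edges C) ?P"
    then obtain a where a: "inj_on a (edges C)" "\<forall>e\<in>edges C. a e \<in> ?P e"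
      by (auto simp: has_SDR_def)
    moreover have "edges C \<subseteq> edges (complete_graph n)"
      using C by (auto simp: copies_of_def subgraph_of_def)
    ultimately have "a ` edges C \<subseteq> {1..?m - 1}" by fastforce
    then have "card (edges C) \<le> ?m - 1"
      using card_inj_on_le[OF a(1), of "{1..?m - 1}"] by simp
    then show False using card_edges_copy[OF H C] assms(2) by simp
  qed
  moreover have "?P \<in> palette_templates l n"
    using assms by (auto simp: palette_templates_def)
  ultimately have P: "?P \<in> {P \<in> palette_templates l n. SDR_free H n P}"
    by (auto simp: SDR_free_def)
  have "real (n choose 2) * ln (real ?m - 1)
      = (\<Sum>e\<in>edges (complete_graph n). ln (real (card (?P e))))"
    using n_subsets[of "{1..n}" 2] assms(2)
    by (simp add: complete_graph_def pairs_of_def of_nat_diff)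
  also have "\<dots> \<le> ex_log n H l"
    unfolding ex_log_def by (intro Max_ge imageI P) (simp add: finite_palette_templates)
  finally show ?thesis .
qed

theorem corollary3p3:
  fixes H :: "'a ugraph" and l :: nat
  assumes "finite_simple_graph H"
    and "no_isolated_vertices H"
    and "non_matching H"
    and "card (edges H) \<ge> 3"
    and "card (edges H) \<le> l"
    and "real l \<le> (real (card (edges H)) - 1) powr
                  (real (card (edges H)) / (real (card (edges H)) - 2))"
  shows "lambda_density H l = ln (real (card (edges H)) - 1)"
proof -
  have "edges H \<noteq> {}" using assms(4) by auto
  then obtain e where "e \<in> edges H" by blast
  then have "e \<subseteq> verts H" "card e = 2" "finite (verts H)"
    using assms(1) by (auto simp: finite_simple_graph_def pairs_of_def)
  \<comment> \<open>This makes \<open>n choose 2\<close> positive for all \<open>n\<close> in the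
    range of the infimum, so no quotient takes the default value of division by zero.\<close>
  then have v: "card (verts H) \<ge> 2" using card_mono by metis
  \<comment> \<open>The two bounds agree for every admissible \<open>n\<close>, so the infimum is
    over a constant family and no limit is involved.\<close>
  have "ex_log n H l / real (n choose 2) = ln (real (card (edges H)) - 1)"
    if n: "n \<in> {card (verts H)..}" for n
  proof -
    have "ex_log n H l = real (n choose 2) * ln (real (card (edges H)) - 1)"
      using ex_log_le[of H l n] ex_log_ge[of H l n] assms n by (intro antisym) auto
    moreover have "n choose 2 > 0" using v n by simp
    ultimately show ?thesis by simp
  qed
  then have "lambda_density H l = (INF n\<in>{card (verts H)..}. ln (real (card (edges H)) - 1))"
    unfolding lambda_density_def by (rule INF_cong[OF refl])
  then show ?thesis by simp
qed

end
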